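(* Let $0\le K\le N$ and $1\le T\le 2^N$ be integers and consider an ORB-type GRAND algorithm with ordered list of distinct error patterns $\underline{e}(1),\dots,\underline{e}(T)\in\mathbb{F}_2^N$ and permutation law $\underline{y}\mapsto\pi_{\underline{y}}$, used over a memoryless binary-input channel. Then its block error rate averaged over the random code ensemble (a uniformly random set of $2^K$ distinct codewords in $\mathbb{F}_2^N$) is $$P_{\mathrm{err}} = 1-P_{\mathrm{succ}} = 1-\sum_{t=1}^{T}p_t\left(\prod_{i=1}^{t-1}\frac{2^N-2^K+1-i}{2^N-i}\right),$$ where $p_t=\mathbf{E}_{\underline{Y}}\left[P_{\underline{W}|\underline{Y}}(\theta(\underline{Y})\oplus\pi_{\underline{Y}}(\underline{e}(t))\mid\underline{Y})\right]$ and $T$ is the maximum number of tests allowed.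
   Context: Channel: $q_0,q_1$ are probability densities on $\mathbb{R}$; when $\underline{w}\in\mathbb{F}_2^N$ is sent, the output $\underline{Y}\in\mathbb{R}^N$ has density $\prod_i q_{w_i}(y_i)$. The log-likelihood ratios are $\ell_i=\log(q_0(y_i)/q_1(y_i))$ and the hard decision is $\theta(\underline{y})\in\mathbb{F}_2^N$ with $\theta(\underline y)_i=\mathbf{1}(\ell_i<0)$. ORB-type GRAND: an ordered list of $T$ distinct vectors $\underline{e}(1),\dots,\underline{e}(T)\in\mathbb{F}_2^N$ (error patterns) is fixed in advance, independent of $\underline{Y}$; a permutation law assigns (measurably) to each $\underline{y}\in\mathbb{R}^N$ a permutation $\pi_{\underline{y}}$ of the coordinates $\{1,\dots,N\}$, acting on vectors of $\mathbb{F}_2^N$ by permuting coordinates. Given $\underline{y}$ and a codebook $\mathcal{C}$, the decoder tests for $t=1,2,\dots,T$ whether $\theta(\underline{y})\oplus\pi_{\underline{y}}(\underline{e}(t))\in\mathcal{C}$; it stops at the first $t$ for which this holds and outputs that codeword; if no $t\le T$ works, it declares failure. An error occurs whenever the output is not the transmitted codeword (failure counts as an error). Random code ensemble: the codewords $\underline{W}(1),\dots,\underline{W}(2^K)$ are drawn sequentially, uniformly without replacement, from $\mathbb{F}_2^N$; the transmitted message index is uniform on $\{1,\dots,2^K\}$ and independent of the codebook, and given the codebook and index the output $\underline{Y}$ depends only on the transmitted codeword. $P_{\mathrm{err}}$ is the error probability averaged over codebook, message and channel; $P_{\mathrm{succ}}=1-P_{\mathrm{err}}$. In $p_t$ (the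 average guessing posterior of $\underline e(t)$), $\underline{W}$ is the transmitted codeword (uniform on $\mathbb{F}_2^N$ after averaging over the ensemble), $\underline{Y}$ is the corresponding output, and $P_{\underline{W}|\underline{Y}}$ is the ensemble-averaged posterior. Empty products equal $1$. *)

theory Defs
  imports "HOL-Probability.Probability" "HOL-Combinatorics.Combinatorics" "HOL-Library.Z2"
begin

text \<open>
  Elements of \<open>F_2^N\<close> are the lists over the two-element field \<^typ>\<open>bit\<close> of length \<open>N\<close>;
  coordinates are numbered \<open>0, ..., N - 1\<close>.
\<close>

definition words :: "nat \<Rightarrow> bit list set" where
  "words N = {w. length w = N}"

definition word_add :: "bit list \<Rightarrow> bit list \<Rightarrow> bit list" where
  "word_add u v = map2 (+) u v"

definition outputs :: "nat \<Rightarrow> (nat \<Rightarrow> real) measure" where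
  "outputs N = (\<Pi>\<^sub>M i\<in>{..<N}. lborel)"

definition prob_density :: "(real \<Rightarrow> real) \<Rightarrow> bool" where
  "prob_density f \<longleftrightarrow>
     f \<in> borel_measurable borel \<and> (\<forall>x. 0 \<le> f x) \<and> (\<integral>\<^sup>+x. ennreal (f x) \<partial>lborel) = 1"

definition channel :: "(bit \<Rightarrow> real \<Rightarrow> real) \<Rightarrow> nat \<Rightarrow> bit list \<Rightarrow> (nat \<Rightarrow> real) measure" where
  "channel q N w = density (outputs N) (\<lambda>y. ennreal (\<Prod>i<N. q (w ! i) (y i)))"

text \<open>
  The log-likelihood ratio is extended-real-valued, with \<open>log 0 = - \<infinity>\<close> and \<open>log (a / 0) = \<infinity>\<close>
  for \<open>a > 0\<close> (the totalised real functions \<^const>\<open>ln\<close> and \<open>/\<close> would give \<open>0\<close> there).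
  The case \<open>0 / 0\<close> has probability zero under both inputs; its value is a mere convention.
\<close>

definition llr :: "(bit \<Rightarrow> real \<Rightarrow> real) \<Rightarrow> real \<Rightarrow> ereal" where
  "llr q x =
     (if q 1 x = 0 then (if q 0 x = 0 then 0 else \<infinity>)
      else if q 0 x = 0 then - \<infinity>
      else ereal (ln (q 0 x / q 1 x)))"

definition hard_decision :: "(bit \<Rightarrow> real \<Rightarrow> real) \<Rightarrow> nat \<Rightarrow> (nat \<Rightarrow> real) \<Rightarrow> bit list" where
  "hard_decision q N y = map (\<lambda>i. if llr q (y i) < 0 then 1 else 0) [0..<N]"

definition permutation_law :: "nat \<Rightarrow> ((nat \<Rightarrow> real) \<Rightarrow> nat \<Rightarrow> nat) \<Rightarrow> bool" where
  "permutation_law N \<pi> \<longleftrightarrow> \<pi> \<in> measurable (outputs N) (count_space {\<sigma>. \<sigma> permutes {..<N}})"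

definition guess ::
  "(bit \<Rightarrow> real \<Rightarrow> real) \<Rightarrow> nat \<Rightarrow> ((nat \<Rightarrow> real) \<Rightarrow> nat \<Rightarrow> nat) \<Rightarrow>
     bit list \<Rightarrow> (nat \<Rightarrow> real) \<Rightarrow> bit list" where
  "guess q N \<pi> v y = word_add (hard_decision q N y) (permute_list (\<pi> y) v)"

text \<open>The result \<^const>\<open>None\<close> stands for a declared decoding failure.\<close>

definition decode ::
  "(bit \<Rightarrow> real \<Rightarrow> real) \<Rightarrow> nat \<Rightarrow> ((nat \<Rightarrow> real) \<Rightarrow> nat \<Rightarrow> nat) \<Rightarrow> (nat \<Rightarrow> bit list) \<Rightarrow> nat \<Rightarrow>
     bit list set \<Rightarrow> (nat \<Rightarrow> real) \<Rightarrow> bit list option" where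
  "decode q N \<pi> e T C y = find (\<lambda>w. w \<in> C) (map (\<lambda>t. guess q N \<pi> (e t) y) [1..<Suc T])"

fun random_codebook :: "nat \<Rightarrow> nat \<Rightarrow> bit list list pmf" where
  "random_codebook N 0 = return_pmf []"
| "random_codebook N (Suc m) =
     bind_pmf (random_codebook N m) (\<lambda>ws.
     bind_pmf (pmf_of_set (words N - set ws)) (\<lambda>w.
     return_pmf (ws @ [w])))"

text \<open>
  The joint law of codebook, message index (numbered from \<open>0\<close>) and channel output.
\<close>

type_synonym outcome = "(bit list list \<times> nat) \<times> (nat \<Rightarrow> real)"

definition ensemble :: "(bit \<Rightarrow> real \<Rightarrow> real) \<Rightarrow> nat \<Rightarrow> nat \<Rightarrow> outcome measure" where
  "ensemble q N K =
     measure_pmf (pair_pmf (random_codebook N (2 ^ K)) (pmf_of_set {..<2 ^ K})) \<bind>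
       (\<lambda>(ws, m). distr (channel q N (ws ! m)) (count_space UNIV \<Otimes>\<^sub>M outputs N)
                     (\<lambda>y. ((ws, m), y)))"

definition codebook :: "outcome \<Rightarrow> bit list set" where
  "codebook \<omega> = set (fst (fst \<omega>))"

definition sent :: "outcome \<Rightarrow> bit list" where
  "sent \<omega> = fst (fst \<omega>) ! snd (fst \<omega>)"

definition received :: "outcome \<Rightarrow> nat \<Rightarrow> real" where
  "received \<omega> = snd \<omega>"

definition P_err ::
  "(bit \<Rightarrow> real \<Rightarrow> real) \<Rightarrow> nat \<Rightarrow> nat \<Rightarrow> ((nat \<Rightarrow> real) \<Rightarrow> nat \<Rightarrow> nat) \<Rightarrow>
     (nat \<Rightarrow> bit list) \<Rightarrow> nat \<Rightarrow> real" where
  "P_err q N K \<pi> e T =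
     measure (ensemble q N K)
       {\<omega> \<in> space (ensemble q N K).
          decode q N \<pi> e T (codebook \<omega>) (received \<omega>) \<noteq> Some (sent \<omega>)}"

definition P_succ ::
  "(bit \<Rightarrow> real \<Rightarrow> real) \<Rightarrow> nat \<Rightarrow> nat \<Rightarrow> ((nat \<Rightarrow> real) \<Rightarrow> nat \<Rightarrow> nat) \<Rightarrow>
     (nat \<Rightarrow> bit list) \<Rightarrow> nat \<Rightarrow> real" where
  "P_succ q N K \<pi> e T = 1 - P_err q N K \<pi> e T"

text \<open>
  The posterior \<open>P(W = w | Y)\<close> under the ensemble law, as a random variable: the conditional
  expectation of the indicator of \<open>W = w\<close> given the sigma-algebra generated by \<open>Y\<close>.
\<close>

definition posterior ::
  "(bit \<Rightarrow> real \<Rightarrow> real) \<Rightarrow> nat \<Rightarrow> nat \<Rightarrow> bit list \<Rightarrow> outcome \<Rightarrow> real" where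
  "posterior q N K w =
     real_cond_exp (ensemble q N K)
       (vimage_algebra (space (ensemble q N K)) received (outputs N))
       (indicator {\<omega>. sent \<omega> = w})"

definition avg_guess_posterior ::
  "(bit \<Rightarrow> real \<Rightarrow> real) \<Rightarrow> nat \<Rightarrow> nat \<Rightarrow> ((nat \<Rightarrow> real) \<Rightarrow> nat \<Rightarrow> nat) \<Rightarrow>
     bit list \<Rightarrow> real" where
  "avg_guess_posterior q N K \<pi> v =
     (\<integral>\<omega>. posterior q N K (guess q N \<pi> v (received \<omega>)) \<omega> \<partial>ensemble q N K)"

end

theory Submission
  imports Defs
begin

text \<open>
  The decoder succeeds at test \<open>t\<close> iff the \<open>t\<close>-th guess is the sent word and none of the earlier
  guesses, which are \<open>t - 1\<close> other words, is in the codebook. Integrating over the output last,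
  the output enters only through the likelihood of the \<open>t\<close>-th guess: for a fixed output, the
  probability over codebook and message that a given word is sent and that \<open>s\<close> given other words are
  avoided depends on \<open>s\<close> only. Hence the second requirement contributes a constant factor, which
  is the product in the formula, and the remaining probability that the \<open>t\<close>-th guess is the
  sent word is the expected posterior, because the guess is a function of the output.
\<close>

subsection \<open>Random codebooks\<close>

instance bit :: finite
proof
  have "UNIV = {0, 1::bit}" by auto
  then show "finite (UNIV :: bit set)" by (metis finite.emptyI finite.insertI)
qed

lemma card_UNIV_bit: "card (UNIV :: bit set) = 2"
proof -
  have "UNIV = {0, 1::bit}" by auto
  then show ?thesis by (metis card_2_iff zero_neq_one)
qed

lemma finite_words: "finite (words N)" and card_words: "card (words N) = 2 ^ N"
  using finite_lists_length_eq[of "UNIV :: bit set" N] card_lists_length_eq[of "UNIV :: bit set" N]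
  by (simp_all add: words_def card_UNIV_bit)

lemma falling_factorial_add:
  fixes x :: real
  shows "(\<Prod>i<a + b. x - real i) = (\<Prod>i<a. x - real i) * (\<Prod>i<b. x - real a - real i)"
  by (induction b) (auto simp: algebra_simps)

text \<open>The bound \<open>m \<le> 2 ^ N\<close> keeps \<open>words N - set ws\<close> nonempty at
  every draw, so that \<open>pmf_of_set\<close> really is the uniform law on the words not yet
  drawn.\<close>

lemma set_pmf_random_codebook:
  assumes "m \<le> 2 ^ N" "ws \<in> set_pmf (random_codebook N m)"
  shows "length ws = m" "distinct ws" "set ws \<subseteq> words N"
proof -
  have "length ws = m \<and> distinct ws \<and> set ws \<subseteq> words N"
    using assms
  proof (induction m arbitrary: ws)
    case (Suc m)
    then obtain vs w where vs: "vs \<in> set_pmf (random_codebook N m)"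
      and w: "w \<in> set_pmf (pmf_of_set (words N - set vs))" and ws: "ws = vs @ [w]"
      by auto
    have *: "length vs = m" "distinct vs" "set vs \<subseteq> words N"
      using Suc.IH[OF _ vs] Suc.prems by auto
    then have "card (set vs) < card (words N)"
      using Suc.prems by (simp add: distinct_card card_words)
    then have "words N - set vs \<noteq> {}"
      using card_mono[of "set vs" "words N"] by auto
    then have "w \<in> words N - set vs"
      using w by (simp add: finite_words)
    then show ?case using * ws by auto
  qed simp
  then show "length ws = m" "distinct ws" "set ws \<subseteq> words N" by auto
qed

lemma prob_bind_pmf:
  "measure_pmf.prob (bind_pmf p f) A = (\<integral>x. measure_pmf.prob (f x) A \<partial>p)"
  unfolding measure_pmf_bind
  by (rule measure_pmf.measure_bind[where N = "count_space UNIV"])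
    (auto simp: space_subprob_algebra subprob_space_measure_pmf)

text \<open>After \<open>i\<close> draws that avoid \<open>S\<close>, there are
  \<open>2 ^ N - i\<close> words left, of which \<open>2 ^ N - card S - i\<close> lie outside
  \<open>S\<close>. If \<open>S\<close> is too large to be avoided by \<open>m\<close> distinct
  words, one of the factors is zero, so the formula needs no case distinction.\<close>

lemma prob_random_codebook_avoids:
  assumes "m \<le> 2 ^ N" "S \<subseteq> words N"
  shows "measure_pmf.prob (random_codebook N m) {ws. set ws \<inter> S = {}} =
    (\<Prod>i<m. (2 ^ N - real (card S) - real i) / (2 ^ N - real i))"
  using assms(1)
proof (induction m)
  case 0
  then show ?case by simp
next
  case (Suc m)
  let ?A = "{ws. set ws \<inter> S = {}}"
  let ?c = "(2 ^ N - real (card S) - real m) / (2 ^ N - real m)"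
  let ?next = "\<lambda>ws. pmf_of_set (words N - set ws) \<bind> (\<lambda>w. return_pmf (ws @ [w]))"
  have finS: "finite S" using assms(2) finite_words finite_subset by blast
  have step: "measure_pmf.prob (?next ws) ?A = indicator ?A ws * ?c"
    if "ws \<in> set_pmf (random_codebook N m)" for ws
  proof -
    have ws: "length ws = m" "distinct ws" "set ws \<subseteq> words N"
      using set_pmf_random_codebook[OF _ that] Suc.prems by auto
    have card_rest: "card (words N - set ws) = 2 ^ N - m"
      using ws by (simp add: card_Diff_subset card_words distinct_card)
    then have ne: "words N - set ws \<noteq> {}"
      using Suc.prems by (metis Suc_le_lessD card.empty less_numeral_extra(3) zero_less_diff)
    have "?next ws = map_pmf (\<lambda>w. ws @ [w]) (pmf_of_set (words N - set ws))"
      by (simp add: map_pmf_def)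
    then have "measure_pmf.prob (?next ws) ?A =
        measure_pmf.prob (pmf_of_set (words N - set ws)) ((\<lambda>w. ws @ [w]) -` ?A)"
      by simp
    also have "\<dots> = card ((words N - set ws) \<inter> (\<lambda>w. ws @ [w]) -` ?A) / card (words N - set ws)"
      using ne finite_words by (simp add: measure_pmf_of_set)
    also have "\<dots> = indicator ?A ws * ?c"
    proof (cases "ws \<in> ?A")
      case True
      then have eq: "(words N - set ws) \<inter> (\<lambda>w. ws @ [w]) -` ?A = words N - (set ws \<union> S)"
        by auto
      have c: "card (set ws \<union> S) = m + card S"
        using True ws finS by (simp add: card_Un_disjoint distinct_card)
      \<comment> \<open>This makes the natural-number subtraction in the cardinality below exact, so
        it agrees with the real one.\<close>
      have "m + card S \<le> 2 ^ N"
        using card_mono[OF finite_words, of "set ws \<union> S" N] ws assms(2) c by (simp add: card_words)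
      then have "real (card (words N - (set ws \<union> S))) = 2 ^ N - real (card S) - real m"
        using ws assms(2) finS c by (simp add: card_Diff_subset card_words of_nat_diff)
      then show ?thesis using True eq card_rest Suc.prems by (simp add: of_nat_diff)
    next
      case False
      then have "(words N - set ws) \<inter> (\<lambda>w. ws @ [w]) -` ?A = {}" by auto
      with False show ?thesis by simp
    qed
    finally show ?thesis .
  qed
  have "measure_pmf.prob (random_codebook N (Suc m)) ?A =
      (\<integral>ws. measure_pmf.prob (?next ws) ?A \<partial>random_codebook N m)"
    by (simp only: random_codebook.simps prob_bind_pmf)
  also have "\<dots> = (\<integral>ws. indicator ?A ws * ?c \<partial>random_codebook N m)"
    by (intro integral_cong_AE) (auto simp: AE_measure_pmf_iff step)
  also have "\<dots> = measure_pmf.prob (random_codebook N m) ?A * ?c"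
    by simp
  finally show ?case using Suc by simp
qed

text \<open>The two numerators share \<open>m - 1\<close> consecutive factors; the remaining factors
  are \<open>L - s\<close> and \<open>L - s - m\<close>, whose difference \<open>m\<close> cancels
  the division. This converts a product over the \<open>m\<close> draws into a product over the
  \<open>s\<close> avoided words.\<close>

lemma falling_factorial_ratio_diff:
  fixes L s m :: nat
  assumes "s < L" "1 \<le> m" "m \<le> L"
  shows "((\<Prod>i<m. (real L - real s - real i) / (real L - real i)) -
      (\<Prod>i<m. (real L - real (Suc s) - real i) / (real L - real i))) / real m =
    1 / real L * (\<Prod>i=1..s. (real L - real m + 1 - real i) / (real L - real i))"
proof -
  define F where "F x n = (\<Prod>i<n. x - real i)" for x :: real and n
  have F_add: "F x (a + b) = F x a * F (x - real a) b" for x a b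
    unfolding F_def by (rule falling_factorial_add)
  obtain k where m: "m = Suc k" using assms(2) by (cases m) auto
  have pos: "F (real L) m > 0" "F (real L) (Suc s) > 0"
    using assms unfolding F_def by (auto intro!: prod_pos simp del: prod.lessThan_Suc)
  have "F (real L - real s) m = (real L - real s) * F (real L - real s - 1) k"
    using F_add[of "real L - real s" 1 k] m by (simp add: F_def)
  moreover have "F (real L - real (Suc s)) m =
      F (real L - real s - 1) k * (real L - real s - 1 - real k)"
    by (simp add: F_def m algebra_simps)
  ultimately have diff: "F (real L - real s) m - F (real L - real (Suc s)) m =
      real m * F (real L - real s - 1) k"
    by (simp add: m algebra_simps)
  \<comment> \<open>Both sides are the falling factorial of \<open>L\<close> with
    \<open>s + m\<close> factors, cut after \<open>s + 1\<close> factors on the left and after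
    \<open>m\<close> on the right.\<close>
  have split: "F (real L) (Suc s) * F (real L - real s - 1) k = F (real L) m * F (real L - real m) s"
    using F_add[of "real L" "Suc s" k] F_add[of "real L" m s] by (simp add: m algebra_simps)
  have tail: "F (real L) (Suc s) = real L * F (real L - 1) s"
    using F_add[of "real L" 1 s] by (simp add: F_def)
  \<comment> \<open>Indices starting at 1 lower the starting point by one, which accounts for the
    \<open>+ 1\<close> in the numerators of the final formula.\<close>
  have shift: "(\<Prod>i=1..s. x - real i) = F (x - 1) s" for x
    unfolding F_def by (rule prod.reindex_bij_witness[of _ Suc "\<lambda>i. i - 1"]) auto
  have "(\<Prod>i=1..s. (real L - real m + 1 - real i) / (real L - real i)) =
      F (real L - real m) s / F (real L - 1) s"
    using shift[of "real L - real m + 1"] shift[of "real L"] by (simp add: prod_dividef)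
  then have rhs: "1 / real L * (\<Prod>i=1..s. (real L - real m + 1 - real i) / (real L - real i)) =
      F (real L - real m) s / F (real L) (Suc s)"
    by (simp add: tail)
  have "((\<Prod>i<m. (real L - real s - real i) / (real L - real i)) -
      (\<Prod>i<m. (real L - real (Suc s) - real i) / (real L - real i))) / real m =
      F (real L - real s - 1) k / F (real L) m"
    using diff assms(2) by (simp add: F_def prod_dividef diff_divide_distrib[symmetric])
  also have "\<dots> = F (real L - real m) s / F (real L) (Suc s)"
    using split pos by (simp add: field_simps)
  finally show ?thesis using rhs by simp
qed

text \<open>
  Given the codebook, the uniform index selects \<open>w\<close> with probability \<open>1 / 2 ^ K\<close> if \<open>w\<close> is in the
  codebook, and \<open>w\<close> is in a codebook avoiding \<open>S\<close> iff the codebook does not avoid \<open>insert w S\<close>.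
\<close>

lemma prob_sent_word_and_codebook_avoids:
  assumes "K \<le> N" "S \<subseteq> words N" "w \<in> words N" "w \<notin> S"
  shows "measure_pmf.prob (pair_pmf (random_codebook N (2 ^ K)) (pmf_of_set {..<2 ^ K}))
      {(ws, j). ws ! j = w \<and> set ws \<inter> S = {}} =
    1 / 2 ^ N * (\<Prod>i=1..card S. (2 ^ N - 2 ^ K + 1 - real i) / (2 ^ N - real i))"
proof -
  let ?m = "2 ^ K :: nat" and ?C = "random_codebook N (2 ^ K)"
  let ?A = "\<lambda>S. {ws. set ws \<inter> S = {}}"
  let ?E = "{(ws, j). ws ! j = w \<and> set ws \<inter> S = {}}"
  have m_le: "?m \<le> 2 ^ N" using assms(1) by (simp add: power_increasing)
  have finS: "finite S" using assms(2) finite_words finite_subset by blast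
  have "card (insert w S) \<le> 2 ^ N"
    using card_mono[OF finite_words, of "insert w S" N] assms by (simp add: card_words)
  then have s_less: "card S < 2 ^ N" using finS assms(4) by simp
  have step: "measure_pmf.prob (map_pmf (Pair ws) (pmf_of_set {..<?m})) ?E =
      (indicator (?A S) ws - indicator (?A (insert w S)) ws) / real ?m"
    if "ws \<in> set_pmf ?C" for ws
  proof -
    have ws: "length ws = ?m" "distinct ws" "set ws \<subseteq> words N"
      using set_pmf_random_codebook[OF m_le that] by auto
    have "measure_pmf.prob (map_pmf (Pair ws) (pmf_of_set {..<?m})) ?E =
        card ({..<?m} \<inter> Pair ws -` ?E) / real ?m"
      by (subst measure_map_pmf) (simp add: measure_pmf_of_set lessThan_empty_iff)
    also have "real (card ({..<?m} \<inter> Pair ws -` ?E)) =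
        indicator (?A S) ws - indicator (?A (insert w S)) ws"
    \<comment> \<open>The codewords are distinct, so at most one index points to \<open>w\<close>
      and the count is 0 or 1.\<close>
    proof (cases "w \<in> set ws \<and> ws \<in> ?A S")
      case True
      then obtain j where j: "j < length ws" "ws ! j = w" by (auto simp: in_set_conv_nth)
      then have "{..<?m} \<inter> Pair ws -` ?E = {j}"
        using True ws by (auto simp: nth_eq_iff_index_eq)
      then show ?thesis using True by simp
    next
      case False
      then have "{..<?m} \<inter> Pair ws -` ?E = {}" using ws by auto
      then show ?thesis using False by (auto simp: indicator_def)
    qed
    finally show ?thesis .
  qed
  have pair: "pair_pmf ?C (pmf_of_set {..<?m}) = ?C \<bind> (\<lambda>ws. map_pmf (Pair ws) (pmf_of_set {..<?m}))"
    by (simp add: pair_pmf_def map_pmf_def)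
  have "measure_pmf.prob (pair_pmf ?C (pmf_of_set {..<?m})) ?E =
      (\<integral>ws. measure_pmf.prob (map_pmf (Pair ws) (pmf_of_set {..<?m})) ?E \<partial>?C)"
    unfolding pair by (rule prob_bind_pmf)
  also have "\<dots> = (\<integral>ws. (indicator (?A S) ws - indicator (?A (insert w S)) ws) / real ?m \<partial>?C)"
    by (intro integral_cong_AE) (auto simp: AE_measure_pmf_iff step simp del: measure_map_pmf)
  also have "\<dots> = (measure_pmf.prob ?C (?A S) - measure_pmf.prob ?C (?A (insert w S))) / real ?m"
    by (simp add: Bochner_Integration.integral_diff measure_pmf.emeasure_eq_measure)
  \<comment> \<open>As \<open>w \<notin> S\<close>, the two avoided sets have sizes
    \<open>card S\<close> and \<open>card S + 1\<close>, the consecutive values in the falling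
    factorial identity.\<close>
  also have "\<dots> = 1 / 2 ^ N * (\<Prod>i=1..card S. (2 ^ N - 2 ^ K + 1 - real i) / (2 ^ N - real i))"
    using falling_factorial_ratio_diff[OF s_less, of ?m] m_le assms finS
      prob_random_codebook_avoids[OF m_le assms(2)]
      prob_random_codebook_avoids[OF m_le, of "insert w S"]
    by simp
  finally show ?thesis .
qed

subsection \<open>The law of the ensemble\<close>

definition likelihood :: "(bit \<Rightarrow> real \<Rightarrow> real) \<Rightarrow> nat \<Rightarrow> bit list \<Rightarrow> (nat \<Rightarrow> real) \<Rightarrow> ennreal" where
  "likelihood q N w y = ennreal (\<Prod>i<N. q (w ! i) (y i))"

definition message_law :: "nat \<Rightarrow> nat \<Rightarrow> (bit list list \<times> nat) pmf" where
  "message_law N K = pair_pmf (random_codebook N (2 ^ K)) (pmf_of_set {..<2 ^ K})"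

lemma sigma_finite_outputs: "sigma_finite_measure (outputs N)"
proof -
  interpret product_sigma_finite "\<lambda>_::nat. lborel :: real measure" ..
  show ?thesis unfolding outputs_def by (rule sigma_finite) simp
qed

section \<open>Hard decisions and guesses at a fixed output\<close>

lemma bit_indicator_eq_iff: "(if c then 1 else 0) = (b :: bit) \<longleftrightarrow> (c \<longleftrightarrow> b = 1)"
  by (cases c) (metis bit_not_zero_iff zero_neq_one)+

lemma hard_decision_eq_iff:
  "hard_decision q N y = w \<longleftrightarrow> length w = N \<and> (\<forall>i\<in>{..<N}. llr q (y i) < 0 \<longleftrightarrow> w ! i = 1)"
proof -
  have "hard_decision q N y = w \<longleftrightarrow>
    length w = N \<and> (\<forall>i\<in>{..<N}. (if llr q (y i) < 0 then 1 else 0) = w ! i)"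
    unfolding hard_decision_def list_eq_iff_nth_eq by (simp cong: conj_cong if_cong) blast
  then show ?thesis by (simp only: bit_indicator_eq_iff)
qed

lemma guess_in_words: "v \<in> words N \<Longrightarrow> guess q N \<pi> v y \<in> words N"
  by (simp add: guess_def words_def word_add_def hard_decision_def)

text \<open>Adding the hard decision and permuting coordinates are both injective. Distinct error
  patterns thus give distinct guesses at each output, and the guesses before test \<open>t\<close>
  are exactly \<open>t - 1\<close> words.\<close>

lemma guess_inj:
  assumes "\<pi> y permutes {..<N}" "u \<in> words N" "v \<in> words N" "guess q N \<pi> u y = guess q N \<pi> v y"
  shows "u = v"
proof (rule nth_equalityI)
  show len: "length u = length v" using assms by (simp add: words_def)
  fix i assume "i < length u"
  then have i: "i < N" using assms by (simp add: words_def)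
  \<comment> \<open>\<open>permute_list\<close> places entry \<open>\<pi> y j\<close> at position
    \<open>j\<close>, so entry \<open>i\<close> is found at the preimage of
    \<open>i\<close>.\<close>
  define j where "j = inv (\<pi> y) i"
  have j: "j < N" "\<pi> y j = i"
    using i assms(1) permutes_inverses(1)[OF assms(1)] permutes_in_image[OF permutes_inv[OF assms(1)]]
    by (auto simp: j_def)
  have "guess q N \<pi> u y ! j = guess q N \<pi> v y ! j" using assms(4) by simp
  then have "hard_decision q N y ! j + permute_list (\<pi> y) u ! j =
      hard_decision q N y ! j + permute_list (\<pi> y) v ! j"
    using assms(2,3) j(1) by (simp add: guess_def word_add_def words_def hard_decision_def del: add_bit_eq_xor)
  then have "permute_list (\<pi> y) u ! j = permute_list (\<pi> y) v ! j" by (simp only: add_left_cancel)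
  then show "u ! i = v ! i"
    using assms(1-3) j by (simp add: permute_list_nth words_def)
qed

text \<open>Codebook and index range over a countable discrete type, so joint measurability can be
  checked with the message held fixed.\<close>

lemma pred_outcome:
  assumes "\<And>p. Measurable.pred (outputs N) (R p)"
  shows "Measurable.pred (count_space UNIV \<Otimes>\<^sub>M outputs N)
    (\<lambda>\<omega>. R (fst \<omega> :: bit list list \<times> nat) (snd \<omega>))"
  by (rule measurable_pair_measure_countable1) (use assms in auto)

section \<open>The channel and the ensemble for fixed input densities\<close>

context
  fixes q :: "bit \<Rightarrow> real \<Rightarrow> real"
  assumes density: "\<And>b. prob_density (q b)"
begin

lemma density_measurable [measurable]: "q b \<in> borel_measurable borel"
  using density by (simp add: prob_density_def)

lemma density_nonneg: "0 \<le> q b x"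
  using density by (simp add: prob_density_def)

lemma likelihood_measurable [measurable]: "likelihood q N w \<in> borel_measurable (outputs N)"
  unfolding likelihood_def outputs_def by measurable

lemma channel_eq: "channel q N w = density (outputs N) (likelihood q N w)"
  by (simp add: channel_def likelihood_def[abs_def])

lemma prob_space_channel: "prob_space (channel q N w)"
proof
  interpret product_sigma_finite "\<lambda>_::nat. lborel :: real measure" ..
  have "emeasure (channel q N w) (space (channel q N w)) =
      (\<integral>\<^sup>+y. likelihood q N w y \<partial>outputs N)"
    unfolding channel_eq by (simp add: emeasure_density cong: nn_integral_cong_simp)
  also have "\<dots> = (\<integral>\<^sup>+y. (\<Prod>i<N. ennreal (q (w ! i) (y i))) \<partial>outputs N)"
    by (simp add: likelihood_def prod_ennreal density_nonneg)
  also have "\<dots> = (\<Prod>i<N. \<integral>\<^sup>+x. ennreal (q (w ! i) x) \<partial>lborel)"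
    unfolding outputs_def by (rule product_nn_integral_prod) auto
  also have "\<dots> = 1"
    using density by (simp add: prob_density_def)
  finally show "emeasure (channel q N w) (space (channel q N w)) = 1" .
qed

abbreviation transmission :: "nat \<Rightarrow> bit list list \<times> nat \<Rightarrow> outcome measure" where
  "transmission N p \<equiv>
    distr (channel q N (fst p ! snd p)) (count_space UNIV \<Otimes>\<^sub>M outputs N) (Pair p)"

lemma ensemble_eq: "ensemble q N K = measure_pmf (message_law N K) \<bind> transmission N"
  by (simp add: ensemble_def message_law_def case_prod_beta')

lemma sets_channel [measurable_cong, simp]: "sets (channel q N w) = sets (outputs N)"
  by (simp add: channel_def)

lemma space_channel [simp]: "space (channel q N w) = space (outputs N)"
  by (simp add: channel_def)

lemma prob_space_transmission: "prob_space (transmission N p)"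
  by (rule prob_space.prob_space_distr[OF prob_space_channel]) measurable

lemma measurable_transmission:
  "transmission N \<in> measure_pmf M \<rightarrow>\<^sub>M subprob_algebra (count_space UNIV \<Otimes>\<^sub>M outputs N)"
  using prob_space_transmission prob_space_imp_subprob_space
  by (auto simp: space_subprob_algebra)

lemma sets_ensemble [measurable_cong, simp]:
  "sets (ensemble q N K) = sets (count_space UNIV \<Otimes>\<^sub>M outputs N)"
  unfolding ensemble_eq by (rule sets_bind_measurable[OF measurable_transmission]) simp

lemma space_ensemble: "space (ensemble q N K) = UNIV \<times> space (outputs N)"
  using sets_eq_imp_space_eq[OF sets_ensemble] by (simp add: space_pair_measure)

lemma prob_space_ensemble: "prob_space (ensemble q N K)"
  unfolding ensemble_eq
  by (rule measure_pmf.prob_space_bind[OF _ measurable_transmission])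
    (simp add: prob_space_transmission)

text \<open>Tonelli moves the integral over the output to the outside. For a fixed output only the
  discrete law of codebook and index is left inside, where counting applies.\<close>

lemma emeasure_ensemble:
  assumes R: "\<And>p. Measurable.pred (outputs N) (R p)"
  shows "emeasure (ensemble q N K) {\<omega> \<in> space (ensemble q N K). R (fst \<omega>) (snd \<omega>)} =
    (\<integral>\<^sup>+y. (\<integral>\<^sup>+p. likelihood q N (fst p ! snd p) y * indicator {p. R p y} p
      \<partial>message_law N K) \<partial>outputs N)"
proof -
  let ?A = "{\<omega> \<in> space (ensemble q N K). R (fst \<omega>) (snd \<omega>)}"
  note [measurable] = R
  interpret pair_sigma_finite "measure_pmf (message_law N K)" "outputs N"
    by (intro pair_sigma_finite.intro sigma_finite_outputs measure_pmf.sigma_finite_measure_axioms)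
  have A: "?A \<in> sets (count_space UNIV \<Otimes>\<^sub>M outputs N)"
    using pred_outcome[OF R] unfolding pred_def
    by (simp add: space_ensemble space_pair_measure)
  have "emeasure (ensemble q N K) ?A = (\<integral>\<^sup>+p. emeasure (transmission N p) ?A \<partial>message_law N K)"
    unfolding ensemble_eq
    by (rule emeasure_bind[OF _ measurable_transmission])
      (use A in \<open>auto simp: ensemble_eq\<close>)
  also have "\<dots> = (\<integral>\<^sup>+p. (\<integral>\<^sup>+y. likelihood q N (fst p ! snd p) y * indicator {p. R p y} p
      \<partial>outputs N) \<partial>message_law N K)"
  proof (intro nn_integral_cong)
    fix p :: "bit list list \<times> nat"
    have "emeasure (transmission N p) ?A =
        emeasure (channel q N (fst p ! snd p)) {y \<in> space (outputs N). R p y}"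
      using A by (subst emeasure_distr) (auto simp: space_ensemble intro!: arg_cong2[where f = emeasure])
    also have "\<dots> = (\<integral>\<^sup>+y. likelihood q N (fst p ! snd p) y *
        indicator {y \<in> space (outputs N). R p y} y \<partial>outputs N)"
      unfolding channel_eq by (rule emeasure_density) measurable
    also have "\<dots> = (\<integral>\<^sup>+y. likelihood q N (fst p ! snd p) y * indicator {p. R p y} p \<partial>outputs N)"
      by (intro nn_integral_cong) (auto simp: indicator_def)
    finally show "emeasure (transmission N p) ?A = \<dots>" .
  qed
  also have "\<dots> = (\<integral>\<^sup>+y. (\<integral>\<^sup>+p. likelihood q N (fst p ! snd p) y * indicator {p. R p y} p
      \<partial>message_law N K) \<partial>outputs N)"
  proof (rule Fubini'[symmetric])
    have "(\<lambda>(p, y). likelihood q N (fst p ! snd p) y * indicator {p. R p y} p)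
        \<in> borel_measurable (count_space UNIV \<Otimes>\<^sub>M outputs N)"
    proof (rule measurable_pair_measure_countable1)
      fix p :: "bit list list \<times> nat"
      \<comment> \<open>With \<open>p\<close> fixed, the indicator of a set of messages becomes the
        indicator of a measurable set of outputs.\<close>
      have "(\<lambda>y. likelihood q N (fst p ! snd p) y * indicator {y \<in> space (outputs N). R p y} y)
          \<in> borel_measurable (outputs N)" by measurable
      also have "?this \<longleftrightarrow> (\<lambda>y. case (p, y) of (p, y) \<Rightarrow>
          likelihood q N (fst p ! snd p) y * indicator {p. R p y} p) \<in> borel_measurable (outputs N)"
        by (intro measurable_cong) (auto simp: indicator_def)
      finally show "(\<lambda>y. case (p, y) of (p, y) \<Rightarrow>
          likelihood q N (fst p ! snd p) y * indicator {p. R p y} p) \<in> borel_measurable (outputs N)" .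
    qed simp
    then show "(\<lambda>(p, y). likelihood q N (fst p ! snd p) y * indicator {p. R p y} p)
        \<in> borel_measurable (measure_pmf (message_law N K) \<Otimes>\<^sub>M outputs N)"
      by (simp cong: measurable_cong_sets sets_pair_measure_cong)
  qed
  finally show ?thesis .
qed

lemma AE_sent_in_codebook:
  assumes "K \<le> N"
  shows "AE \<omega> in ensemble q N K. sent \<omega> \<in> codebook \<omega>"
proof -
  let ?R = "\<lambda>p (y :: nat \<Rightarrow> real). fst p ! snd p \<notin> set (fst p :: bit list list)"
  have m_le: "(2::nat) ^ K \<le> 2 ^ N" using assms by (simp add: power_increasing)
  have AE: "AE p in message_law N K. fst p ! snd p \<in> set (fst p)"
    using set_pmf_random_codebook(1)[OF m_le]
    by (auto simp: AE_measure_pmf_iff message_law_def lessThan_empty_iff)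
  have "emeasure (ensemble q N K) {\<omega> \<in> space (ensemble q N K). ?R (fst \<omega>) (snd \<omega>)} = 0"
  proof (subst emeasure_ensemble)
    have "(\<integral>\<^sup>+p. likelihood q N (fst p ! snd p) y * indicator {p. ?R p y} p \<partial>message_law N K) = 0" for y
      by (subst nn_integral_0_iff_AE) (use AE in auto)
    then show "(\<integral>\<^sup>+y. (\<integral>\<^sup>+p. likelihood q N (fst p ! snd p) y * indicator {p. ?R p y} p
        \<partial>message_law N K) \<partial>outputs N) = 0" by simp
  qed simp
  moreover have "{\<omega> \<in> space (ensemble q N K). ?R (fst \<omega>) (snd \<omega>)} \<in> sets (ensemble q N K)"
    using pred_outcome[where N = N and R = ?R] unfolding pred_def by (simp add: space_ensemble space_pair_measure)
  ultimately show ?thesis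
    by (intro AE_I[of _ _ "{\<omega> \<in> space (ensemble q N K). ?R (fst \<omega>) (snd \<omega>)}"])
      (simp_all add: sent_def codebook_def)
qed

text \<open>Here \<open>g\<close> stands for the current guess and \<open>S\<close> for the set of
  earlier guesses, both functions of the output. The size of \<open>S y\<close> is the same for all
  outputs, so the combinatorial factor is constant and leaves the integral.\<close>

lemma emeasure_sent_and_codebook_avoids:
  assumes "K \<le> N"
    and g: "g \<in> outputs N \<rightarrow>\<^sub>M count_space UNIV"
    and S: "\<And>w. Measurable.pred (outputs N) (\<lambda>y. w \<in> S y)"
    and gS: "\<And>y. y \<in> space (outputs N) \<Longrightarrow>
      g y \<in> words N \<and> S y \<subseteq> words N \<and> g y \<notin> S y \<and> card (S y) = s"
  shows "emeasure (ensemble q N K)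
      {\<omega> \<in> space (ensemble q N K). sent \<omega> = g (received \<omega>) \<and> codebook \<omega> \<inter> S (received \<omega>) = {}} =
    ennreal (1 / 2 ^ N * (\<Prod>i=1..s. (2 ^ N - 2 ^ K + 1 - real i) / (2 ^ N - real i))) *
      (\<integral>\<^sup>+y. likelihood q N (g y) y \<partial>outputs N)"
proof -
  let ?R = "\<lambda>p y. fst p ! snd p = g y \<and> (\<forall>w\<in>set (fst p). w \<notin> S y)"
  let ?c = "ennreal (1 / 2 ^ N * (\<Prod>i=1..s. (2 ^ N - 2 ^ K + 1 - real i) / (2 ^ N - real i)))"
  note [measurable] = g S
  have R: "Measurable.pred (outputs N) (?R p)" for p
    by measurable
  have "emeasure (ensemble q N K)
      {\<omega> \<in> space (ensemble q N K). sent \<omega> = g (received \<omega>) \<and> codebook \<omega> \<inter> S (received \<omega>) = {}} =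
      emeasure (ensemble q N K) {\<omega> \<in> space (ensemble q N K). ?R (fst \<omega>) (snd \<omega>)}"
    by (intro arg_cong2[where f = emeasure])
      (auto simp: sent_def received_def codebook_def)
  also have "\<dots> = (\<integral>\<^sup>+y. (\<integral>\<^sup>+p. likelihood q N (fst p ! snd p) y * indicator {p. ?R p y} p
      \<partial>message_law N K) \<partial>outputs N)"
    using R by (rule emeasure_ensemble)
  also have "\<dots> = (\<integral>\<^sup>+y. ?c * likelihood q N (g y) y \<partial>outputs N)"
  proof (intro nn_integral_cong)
    fix y assume y: "y \<in> space (outputs N)"
    have eq: "{p. ?R p y} = {(ws, j). ws ! j = g y \<and> set ws \<inter> S y = {}}"
      by auto
    have "emeasure (message_law N K) {p. ?R p y} = ?c"
      unfolding eq
      using prob_sent_word_and_codebook_avoids[OF assms(1), of "S y" "g y"] gS[OF y]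
      by (simp add: measure_pmf.emeasure_eq_measure message_law_def)
    \<comment> \<open>Where the indicator is nonzero the sent word is \<open>g y\<close>, so the
      likelihood does not vary with \<open>p\<close>.\<close>
    moreover have "(\<integral>\<^sup>+p. likelihood q N (fst p ! snd p) y * indicator {p. ?R p y} p \<partial>message_law N K) =
        (\<integral>\<^sup>+p. likelihood q N (g y) y * indicator {p. ?R p y} p \<partial>message_law N K)"
      by (intro nn_integral_cong) (auto simp: indicator_def)
    ultimately show "(\<integral>\<^sup>+p. likelihood q N (fst p ! snd p) y * indicator {p. ?R p y} p \<partial>message_law N K) =
        ?c * likelihood q N (g y) y"
      by (simp add: nn_integral_cmult_indicator mult.commute)
  qed
  also have "\<dots> = ?c * (\<integral>\<^sup>+y. likelihood q N (g y) y \<partial>outputs N)"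
  proof (rule nn_integral_cmult)
    show "(\<lambda>y. likelihood q N (g y) y) \<in> borel_measurable (outputs N)"
      by (rule measurable_compose_countable[OF likelihood_measurable g])
  qed
  finally show ?thesis .
qed

text \<open>The previous formula is compared with its own instance for the empty avoided set; both
  contain the same likelihood integral.\<close>

lemma measure_sent_and_codebook_avoids:
  assumes "K \<le> N"
    and g: "g \<in> outputs N \<rightarrow>\<^sub>M count_space UNIV"
    and S: "\<And>w. Measurable.pred (outputs N) (\<lambda>y. w \<in> S y)"
    and gS: "\<And>y. y \<in> space (outputs N) \<Longrightarrow>
      g y \<in> words N \<and> S y \<subseteq> words N \<and> g y \<notin> S y \<and> card (S y) = s"
  shows "measure (ensemble q N K)
      {\<omega> \<in> space (ensemble q N K). sent \<omega> = g (received \<omega>) \<and> codebook \<omega> \<inter> S (received \<omega>) = {}} =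
    measure (ensemble q N K) {\<omega> \<in> space (ensemble q N K). sent \<omega> = g (received \<omega>)} *
      (\<Prod>i=1..s. (2 ^ N - 2 ^ K + 1 - real i) / (2 ^ N - real i))"
proof -
  let ?P = "\<Prod>i=1..s. (2 ^ N - 2 ^ K + 1 - real i) / (2 ^ N - real i)"
  \<comment> \<open>Single numerators may be negative, so the sign of the product is read off from
    its meaning as a multiple of a probability. This takes one concrete output, here the zero
    vector.\<close>
  define y where "y = (\<lambda>i\<in>{..<N}. 0 :: real)"
  have "y \<in> space (outputs N)" by (simp add: y_def outputs_def space_PiM)
  note y = gS[OF this]
  have "1 / 2 ^ N * ?P = measure_pmf.prob (pair_pmf (random_codebook N (2 ^ K)) (pmf_of_set {..<2 ^ K}))
      {(ws, j). ws ! j = g y \<and> set ws \<inter> S y = {}}"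
    using prob_sent_word_and_codebook_avoids[OF assms(1), of "S y" "g y"] y by simp
  then have "0 \<le> 1 / 2 ^ N * ?P" by (simp only: measure_nonneg)
  then have "0 \<le> 2 ^ N * (1 / 2 ^ N * ?P)" by (rule mult_nonneg_nonneg[rotated]) simp
  then have P: "0 \<le> ?P" by simp
  have "emeasure (ensemble q N K)
      {\<omega> \<in> space (ensemble q N K). sent \<omega> = g (received \<omega>) \<and> codebook \<omega> \<inter> S (received \<omega>) = {}} =
    ennreal (1 / 2 ^ N * ?P) * (\<integral>\<^sup>+y. likelihood q N (g y) y \<partial>outputs N)"
    by (rule emeasure_sent_and_codebook_avoids[OF assms])
  also have "\<dots> = ennreal ?P * (ennreal (1 / 2 ^ N) * (\<integral>\<^sup>+y. likelihood q N (g y) y \<partial>outputs N))"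
    by (subst ennreal_mult') (simp_all add: mult_ac)
  also have "ennreal (1 / 2 ^ N) * (\<integral>\<^sup>+y. likelihood q N (g y) y \<partial>outputs N) =
      emeasure (ensemble q N K) {\<omega> \<in> space (ensemble q N K). sent \<omega> = g (received \<omega>)}"
    \<comment> \<open>With nothing to avoid the product is empty and equals 1.\<close>
    using emeasure_sent_and_codebook_avoids[OF assms(1) g, of "\<lambda>_. {}" 0] gS by simp
  finally show ?thesis
    using P by (simp add: measure_def enn2real_mult)
qed

section \<open>Measurability of the guesses and the expected posterior\<close>

lemma hard_decision_measurable: "hard_decision q N \<in> outputs N \<rightarrow>\<^sub>M count_space UNIV"
proof -
  have [measurable]: "llr q \<in> borel_measurable borel"
    unfolding llr_def[abs_def] by measurable
  have "Measurable.pred borel (\<lambda>x. llr q x < 0 \<longleftrightarrow> b)" for b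
    by measurable
  then have "Measurable.pred (outputs N) (\<lambda>y. llr q (y i) < 0 \<longleftrightarrow> b)" if "i < N" for i b
    unfolding outputs_def using that by (intro measurable_compose[OF measurable_component_singleton[of i]]) auto
  then have [measurable]:
    "Measurable.pred (outputs N) (\<lambda>y. \<forall>i\<in>{..<N}. llr q (y i) < 0 \<longleftrightarrow> w ! i = 1)" for w :: "bit list"
    by (intro pred_intros_finite(3)) simp_all
  have "{y \<in> space (outputs N). hard_decision q N y = w} \<in> sets (outputs N)" for w
    unfolding hard_decision_eq_iff by measurable
  then show ?thesis
    by (simp add: measurable_count_space_eq2_countable vimage_def Int_def conj_commute)
qed

text \<open>There are only finitely many permutations, so it suffices to treat the guess with the
  permutation frozen.\<close>

lemma guess_measurable:
  assumes "permutation_law N \<pi>"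
  shows "guess q N \<pi> v \<in> outputs N \<rightarrow>\<^sub>M count_space UNIV"
  unfolding guess_def[abs_def]
proof (rule measurable_compose_countable'[where g = \<pi>])
  show "\<pi> \<in> outputs N \<rightarrow>\<^sub>M count_space {\<sigma>. \<sigma> permutes {..<N}}"
    using assms by (simp add: permutation_law_def)
  show "countable {\<sigma>. \<sigma> permutes {..<N}}"
    by (simp add: countable_finite finite_permutations)
  show "(\<lambda>y. word_add (hard_decision q N y) (permute_list \<sigma> v)) \<in> outputs N \<rightarrow>\<^sub>M count_space UNIV" for \<sigma>
    using measurable_compose[OF hard_decision_measurable, of _ "count_space UNIV"] by simp
qed

lemma measurable_received: "received \<in> ensemble q N K \<rightarrow>\<^sub>M outputs N"
  unfolding received_def[abs_def] by measurable

text \<open>The posterior is evaluated at a word that itself depends on the output. Splitting over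
  the finitely many values \<open>w\<close> of the guess gives events in the sigma-algebra of the
  output, and on each of them the defining property of conditional expectation replaces the
  posterior of \<open>w\<close> by the indicator of \<open>w\<close> being sent.\<close>

lemma avg_guess_posterior_eq:
  assumes "permutation_law N \<pi>" "v \<in> words N"
  shows "avg_guess_posterior q N K \<pi> v =
    measure (ensemble q N K)
      {\<omega> \<in> space (ensemble q N K). sent \<omega> = guess q N \<pi> v (received \<omega>)}"
proof -
  let ?E = "ensemble q N K"
  let ?F = "vimage_algebra (space ?E) received (outputs N)"
  let ?G = "\<lambda>w. {\<omega> \<in> space ?E. guess q N \<pi> v (received \<omega>) = w}"
  let ?W = "\<lambda>w. {\<omega>. sent \<omega> = w}"
  interpret prob_space ?E by (rule prob_space_ensemble)
  have received_space: "received \<in> space ?E \<rightarrow> space (outputs N)"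
    by (auto simp: space_ensemble received_def)
  interpret finite_measure_subalgebra ?E ?F
  proof
    show "subalgebra ?E ?F"
      unfolding subalgebra_def sets_vimage_algebra2[OF received_space]
      using measurable_sets[OF measurable_received] by (auto simp del: sets_ensemble)
  qed
  have W: "?W w \<inter> space ?E \<in> sets ?E" for w
    using pred_outcome[where N = N and R = "\<lambda>p y. fst p ! snd p = w"]
    by (auto simp: pred_def sent_def space_ensemble space_pair_measure Int_def conj_commute)
  have indW [measurable]: "(indicator (?W w) :: _ \<Rightarrow> real) \<in> borel_measurable ?E" for w
    using W borel_measurable_indicator_iff by blast
  have "(\<lambda>\<omega>. guess q N \<pi> v (received \<omega>)) \<in> ?F \<rightarrow>\<^sub>M count_space UNIV"
    by (rule measurable_compose[OF measurable_vimage_algebra1[OF received_space] guess_measurable[OF assms(1)]])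
  then have "?G w \<in> sets ?F" for w
    by (auto simp: measurable_count_space_eq2_countable vimage_def Int_def conj_commute)
  then have G [measurable]: "(indicator (?G w) :: _ \<Rightarrow> real) \<in> borel_measurable ?F" for w
    by measurable
  then have G' [measurable]: "(indicator (?G w) :: _ \<Rightarrow> real) \<in> borel_measurable ?E" for w
    by (rule measurable_from_subalg[OF subalg])
  have int: "integrable ?E (\<lambda>\<omega>. indicator (?G w) \<omega> * indicator (?W w) \<omega> :: real)" for w
  proof (rule integrable_const_bound[where B = 1])
    show "AE \<omega> in ?E. norm (indicator (?G w) \<omega> * indicator (?W w) \<omega> :: real) \<le> 1"
      by (simp add: indicator_def)
  qed measurable
  \<comment> \<open>Used twice: with \<open>f\<close> the posterior at \<open>\<omega>\<close>, and
    at the end with \<open>f\<close> the indicator of the sent word, to undo the splitting.\<close>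
  have split: "(\<Sum>w\<in>words N. indicator (?G w) \<omega> * f w) = (f (guess q N \<pi> v (received \<omega>)) :: real)"
    if "\<omega> \<in> space ?E" for \<omega> f
    using that guess_in_words[OF assms(2)] finite_words
    by (simp add: indicator_def if_distrib[of "\<lambda>x. x * _"] sum.delta cong: if_cong)
  have "avg_guess_posterior q N K \<pi> v =
      (\<integral>\<omega>. (\<Sum>w\<in>words N. indicator (?G w) \<omega> * posterior q N K w \<omega>) \<partial>?E)"
    unfolding avg_guess_posterior_def
    by (intro Bochner_Integration.integral_cong) (simp_all add: split)
  also have "\<dots> = (\<Sum>w\<in>words N. \<integral>\<omega>. indicator (?G w) \<omega> * posterior q N K w \<omega> \<partial>?E)"
    unfolding posterior_def
    by (intro Bochner_Integration.integral_sum real_cond_exp_intg(1)[OF int G indW])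
  also have "\<dots> = (\<Sum>w\<in>words N. \<integral>\<omega>. indicator (?G w) \<omega> * indicator (?W w) \<omega> \<partial>?E)"
    unfolding posterior_def
    by (intro sum.cong refl real_cond_exp_intg(2)[OF int G indW])
  also have "\<dots> = (\<integral>\<omega>. (\<Sum>w\<in>words N. indicator (?G w) \<omega> * indicator (?W w) \<omega>) \<partial>?E)"
    by (intro Bochner_Integration.integral_sum[symmetric] int)
  also have "\<dots> = (\<integral>\<omega>. indicator {\<omega> \<in> space ?E. sent \<omega> = guess q N \<pi> v (received \<omega>)} \<omega> \<partial>?E)"
    by (intro Bochner_Integration.integral_cong) (simp_all add: split, simp add: indicator_def)
  also have "\<dots> = measure ?E {\<omega> \<in> space ?E. sent \<omega> = guess q N \<pi> v (received \<omega>)}"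
    by (simp add: Int_def conj_commute)
  finally show ?thesis .
qed

end

subsection \<open>Decoding\<close>

text \<open>Tests are numbered from 1 while \<open>find_Some_iff\<close> speaks of list positions
  from 0; test \<open>t\<close> sits at position \<open>t - 1\<close>.\<close>

lemma decode_eq_Some_iff:
  "decode q N \<pi> e T C y = Some w \<longleftrightarrow>
    (\<exists>t\<in>{1..T}. w = guess q N \<pi> (e t) y \<and> w \<in> C \<and> (\<forall>s\<in>{1..<t}. guess q N \<pi> (e s) y \<notin> C))"
proof -
  have "decode q N \<pi> e T C y = Some w \<longleftrightarrow> (\<exists>i<T. w = guess q N \<pi> (e (Suc i)) y \<and> w \<in> C \<and>
      (\<forall>j<i. guess q N \<pi> (e (Suc j)) y \<notin> C))"
    unfolding decode_def find_Some_iff by (auto simp del: upt_Suc)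
  also have "\<dots> \<longleftrightarrow> (\<exists>t\<in>{1..T}. w = guess q N \<pi> (e t) y \<and> w \<in> C \<and>
      (\<forall>s\<in>{1..<t}. guess q N \<pi> (e s) y \<notin> C))"
  proof safe
    fix i assume "i < T" "guess q N \<pi> (e (Suc i)) y \<in> C" "\<forall>j<i. guess q N \<pi> (e (Suc j)) y \<notin> C"
    then show "\<exists>t\<in>{1..T}. guess q N \<pi> (e (Suc i)) y = guess q N \<pi> (e t) y \<and>
        guess q N \<pi> (e (Suc i)) y \<in> C \<and> (\<forall>s\<in>{1..<t}. guess q N \<pi> (e s) y \<notin> C)"
      by (intro bexI[of _ "Suc i"]) (auto simp: Suc_le_eq gr0_conv_Suc)
  next
    fix t assume "t \<in> {1..T}" "guess q N \<pi> (e t) y \<in> C" "\<forall>s\<in>{1..<t}. guess q N \<pi> (e s) y \<notin> C"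
    then show "\<exists>i<T. guess q N \<pi> (e t) y = guess q N \<pi> (e (Suc i)) y \<and>
        guess q N \<pi> (e t) y \<in> C \<and> (\<forall>j<i. guess q N \<pi> (e (Suc j)) y \<notin> C)"
      by (intro exI[of _ "t - 1"]) auto
  qed
  finally show ?thesis .
qed

theorem theorem1:
  fixes N K T :: nat
    and q :: "bit \<Rightarrow> real \<Rightarrow> real"
    and \<pi> :: "(nat \<Rightarrow> real) \<Rightarrow> nat \<Rightarrow> nat"
    and e :: "nat \<Rightarrow> bit list"
  assumes "prob_density (q 0)" and "prob_density (q 1)"
    and "K \<le> N" and "1 \<le> T" and "T \<le> 2 ^ N"
    and "\<forall>t\<in>{1..T}. e t \<in> words N" and "inj_on e {1..T}"
    and "permutation_law N \<pi>"
  shows "P_err q N K \<pi> e T = 1 - P_succ q N K \<pi> e T \<and>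
         1 - P_succ q N K \<pi> e T =
           1 - (\<Sum>t=1..T. avg_guess_posterior q N K \<pi> (e t) *
                 (\<Prod>i=1..t-1. (2 ^ N - 2 ^ K + 1 - real i) / (2 ^ N - real i)))"
proof -
  have dens: "prob_density (q b)" for b
    using assms(1,2) bit_not_zero_iff[of b] by metis
  let ?E = "ensemble q N K"
  let ?g = "\<lambda>t. guess q N \<pi> (e t)"
  let ?S = "\<lambda>t y. (\<lambda>s. ?g s y) ` {1..<t}"
  let ?P = "\<lambda>s. \<Prod>i=1..s. (2 ^ N - 2 ^ K + 1 - real i) / (2 ^ N - real i)"
  let ?D = "{\<omega> \<in> space ?E. decode q N \<pi> e T (codebook \<omega>) (received \<omega>) = Some (sent \<omega>)}"
  \<comment> \<open>Success at test \<open>t\<close>, stated without requiring the sent word to lie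
    in the codebook, in the form of the avoidance lemma.\<close>
  define B where "B t = {\<omega> \<in> space ?E. sent \<omega> = ?g t (received \<omega>) \<and>
    codebook \<omega> \<inter> ?S t (received \<omega>) = {}}" for t
  interpret prob_space ?E by (rule prob_space_ensemble[OF dens])
  have g_meas [measurable]: "?g t \<in> outputs N \<rightarrow>\<^sub>M count_space UNIV" for t
    by (rule guess_measurable[OF dens assms(8)])
  \<comment> \<open>\<open>permutation_law\<close> makes \<open>\<pi> y\<close> a permutation only
    for \<open>y\<close> in the output space, hence the guard.\<close>
  have inj: "inj_on (\<lambda>t. ?g t y) {1..T}" if "y \<in> space (outputs N)" for y
  proof -
    have "\<pi> \<in> outputs N \<rightarrow>\<^sub>M count_space {\<sigma>. \<sigma> permutes {..<N}}"
      using assms(8) by (simp add: permutation_law_def)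
    from measurable_space[OF this that] have perm: "\<pi> y permutes {..<N}" by simp
    show ?thesis
    proof (rule inj_onI)
      fix s t assume st: "s \<in> {1..T}" "t \<in> {1..T}" "?g s y = ?g t y"
      then have "e s = e t"
        using assms(6) by (intro guess_inj[OF perm _ _ st(3)]) auto
      then show "s = t" using inj_onD[OF assms(7)] st by blast
    qed
  qed
  have g_pred: "Measurable.pred (outputs N) (\<lambda>y. w = ?g t y)" for t w
    by (rule measurable_compose[OF g_meas]) simp
  have S_meas: "Measurable.pred (outputs N) (\<lambda>y. w \<in> ?S t y)" for t w
    unfolding image_iff by (intro pred_intros_finite g_pred) auto
  have B_sets: "B t \<in> sets ?E" for t
  proof -
    let ?R = "\<lambda>p y. fst p ! snd p = ?g t y \<and> (\<forall>w\<in>set (fst p). w \<notin> ?S t y)"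
    have "Measurable.pred (outputs N) (?R p)" for p
      by (intro pred_intros_logic pred_intros_finite g_pred S_meas) auto
    then have "Measurable.pred (count_space UNIV \<Otimes>\<^sub>M outputs N) (\<lambda>\<omega>. ?R (fst \<omega>) (snd \<omega>))"
      by (rule pred_outcome)
    then have "{\<omega> \<in> space ?E. ?R (fst \<omega>) (snd \<omega>)} \<in> sets ?E"
      by (simp only: pred_def sets_ensemble[OF dens] space_ensemble[OF dens] space_pair_measure
          space_count_space)
    also have "{\<omega> \<in> space ?E. ?R (fst \<omega>) (snd \<omega>)} = B t"
      unfolding B_def sent_def received_def codebook_def by blast
    finally show ?thesis .
  qed
  have B_prob: "measure ?E (B t) = avg_guess_posterior q N K \<pi> (e t) * ?P (t - 1)"
    if t: "t \<in> {1..T}" for t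
  proof -
    have conds: "?g t y \<in> words N \<and> ?S t y \<subseteq> words N \<and> ?g t y \<notin> ?S t y \<and> card (?S t y) = t - 1"
      if y: "y \<in> space (outputs N)" for y
    proof (intro conjI)
      show "?g t y \<in> words N"
        using assms(6) t by (intro guess_in_words) auto
      show "?S t y \<subseteq> words N"
        using assms(6) t by (auto intro!: guess_in_words)
      show "?g t y \<notin> ?S t y"
      proof
        assume "?g t y \<in> ?S t y"
        then obtain s where s: "s \<in> {1..<t}" "?g t y = ?g s y" by auto
        then have "t = s" using t by (intro inj_onD[OF inj[OF y] s(2)]) auto
        with s show False by simp
      qed
      have "inj_on (\<lambda>s. ?g s y) {1..<t}"
        by (rule inj_on_subset[OF inj[OF y]]) (use t in auto)
      then show "card (?S t y) = t - 1" by (simp add: card_image)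
    qed
    have "e t \<in> words N" using assms(6) t by blast
    from avg_guess_posterior_eq[OF dens assms(8) this]
      measure_sent_and_codebook_avoids[OF dens assms(3) g_meas S_meas conds]
    show ?thesis unfolding B_def by simp
  qed
  \<comment> \<open>Two tests cannot both guess the sent word, because the guesses at one output are
    distinct.\<close>
  have disj: "disjoint_family_on B {1..T}"
    unfolding disjoint_family_on_def
  proof (intro ballI impI)
    fix s t assume st: "s \<in> {1..T}" "t \<in> {1..T}" "s \<noteq> t"
    have "False" if "\<omega> \<in> B s" "\<omega> \<in> B t" for \<omega>
    proof -
      have "received \<omega> \<in> space (outputs N)"
        using that(1) by (auto simp: B_def received_def space_ensemble[OF dens])
      moreover have "?g s (received \<omega>) = ?g t (received \<omega>)"
        using that by (simp add: B_def)
      ultimately show False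
        using inj_onD[OF inj _ st(1,2)] st(3) by blast
    qed
    then show "B s \<inter> B t = {}" by auto
  qed
  have avoid: "(\<forall>s\<in>{1..<t}. ?g s y \<notin> C) \<longleftrightarrow> C \<inter> ?S t y = {}" for t y and C :: "bit list set"
    by blast
  have D_iff: "\<omega> \<in> ?D \<longleftrightarrow> sent \<omega> \<in> codebook \<omega> \<and> \<omega> \<in> (\<Union>t\<in>{1..T}. B t)" for \<omega>
    unfolding decode_eq_Some_iff avoid B_def by blast
  then have "?D = (\<Union>t\<in>{1..T}. B t) \<inter> {\<omega> \<in> space ?E. sent \<omega> \<in> codebook \<omega>}"
    unfolding B_def by blast
  moreover have "{\<omega> \<in> space ?E. sent \<omega> \<in> codebook \<omega>} \<in> sets ?E"
    using pred_outcome[where N = N and R = "\<lambda>p y. fst p ! snd p \<in> set (fst p)"]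
    by (simp add: pred_def sets_ensemble[OF dens] space_ensemble[OF dens] space_pair_measure
        sent_def codebook_def)
  ultimately have D_sets: "?D \<in> sets ?E" using B_sets by auto
  \<comment> \<open>The two events differ only where the sent word is outside the codebook, which is
    a null set.\<close>
  have "measure ?E ?D = measure ?E (\<Union>t\<in>{1..T}. B t)"
  proof (intro finite_measure_eq_AE)
    show "AE \<omega> in ?E. \<omega> \<in> ?D \<longleftrightarrow> \<omega> \<in> (\<Union>t\<in>{1..T}. B t)"
      using AE_sent_in_codebook[OF dens assms(3)] by eventually_elim (simp only: D_iff simp_thms)
  qed (use D_sets B_sets in auto)
  also have "\<dots> = (\<Sum>t=1..T. measure ?E (B t))"
    by (rule finite_measure_finite_Union) (use disj B_sets in auto)
  also have "\<dots> = (\<Sum>t=1..T. avg_guess_posterior q N K \<pi> (e t) * ?P (t - 1))"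
    by (intro sum.cong refl B_prob)
  finally have "measure ?E ?D = (\<Sum>t=1..T. avg_guess_posterior q N K \<pi> (e t) * ?P (t - 1))" .
  moreover have "P_err q N K \<pi> e T = 1 - measure ?E ?D"
    unfolding P_err_def by (rule prob_neg) (rule D_sets)
  ultimately show ?thesis by (simp add: P_succ_def)
qed

end
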